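(* Let $k \geq 1$ be an integer and let $T$ be a tree on $n \geq k+2$ vertices. Then $sp(T,k) \geq \dfrac{nk+2}{k+1}$. Moreover, this bound is sharp: for every $k \geq 1$ there exist trees $T$ (on infinitely many values of $n \geq k+2$) with $sp(T,k) = \dfrac{nk+2}{k+1}$.
   Context: For a graph $G=(V,E)$ and a subset $B \subseteq V$, the spread of $B$ is $sp(B) = \max_{u \in B} \deg(u) - \min_{v \in B} \deg(v)$, where degrees are taken in $G$. For an integer $k \geq 0$, $sp(G,k)$ is the maximum cardinality of a subset $B \subseteq V$ with $sp(B) \leq k$. *)

theory Defs
  imports Complex_Main "Graph_Theory.Graph_Theory"
begin

text \<open>
  A finite simple graph is a \<open>pair_graph\<close>: a finite vertex set with a symmetric,
  loop-free set of ordered pairs, each edge \<open>uv\<close> being stored as both \<open>(u, v)\<close> and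
  \<open>(v, u)\<close>. The degree of a vertex is therefore the number of arcs leaving it.
\<close>

definition deg :: "'a pair_pre_digraph \<Rightarrow> 'a \<Rightarrow> nat" where
  "deg G v = out_degree (with_proj G) v"

text \<open>
  The library predicate \<open>tree\<close> forbids directed cycles, and in a symmetric digraph
  every edge gives the directed cycle \<open>u, v, u\<close>. The cycles of the undirected graph
  are exactly the directed cycles of length at least 3. The predicate \<open>connected\<close>
  includes that the vertex set is nonempty.
\<close>

definition undirected_tree :: "'a pair_pre_digraph \<Rightarrow> bool" where
  "undirected_tree G \<longleftrightarrow> pair_graph G \<and> connected (with_proj G) \<and>
     \<not> (\<exists>p. pre_digraph.cycle (with_proj G) p \<and> 3 \<le> length p)"

text \<open>Meaningful for finite nonempty \<open>B\<close>, where the subtraction does not truncate.\<close>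

definition spread :: "'a pair_pre_digraph \<Rightarrow> 'a set \<Rightarrow> nat" where
  "spread G B = Max (deg G ` B) - Min (deg G ` B)"

definition sp :: "'a pair_pre_digraph \<Rightarrow> nat \<Rightarrow> nat" where
  "sp G k = Max {card B | B. B \<subseteq> pverts G \<and> B \<noteq> {} \<and> spread G B \<le> k}"

end

theory Submission
  imports Defs
begin

text \<open>
  Let \<open>m\<close> be the number of vertices of degree at least \<open>k + 2\<close>. The degrees of a tree are
  positive and sum to \<open>2 n - 2\<close>, so \<open>(n - m) + m (k + 2) \<le> 2 n - 2\<close>, that is
  \<open>m \<le> (n - 2) / (k + 1)\<close>. The other vertices have degrees in \<open>{1..k + 1}\<close> and there are
  \<open>n - m \<ge> (n k + 2) / (k + 1)\<close> of them.

  Equality holds for trees in which \<open>m\<close> vertices have degree exactly \<open>k + 2\<close> and the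
  remaining \<open>m k + 2\<close> are leaves. Such a tree on \<open>{..<m (k + 1) + 2}\<close> is obtained by giving
  \<open>v > 0\<close> the parent \<open>(v - 2) div (k + 1)\<close>.
\<close>

section \<open>Degrees in forests\<close>

lemma deg_eq_card: "deg G v = card {e \<in> parcs G. fst e = v}"
  by (simp add: deg_def out_degree_def out_arcs_def)

lemma (in pair_fin_digraph) sum_deg: "(\<Sum>v\<in>pverts G. deg G v) = card (parcs G)"
proof -
  have "(\<Sum>v\<in>pverts G. \<Sum>e\<in>{e \<in> parcs G. fst e = v}. 1) = (\<Sum>e\<in>parcs G. 1 :: nat)"
    by (rule sum.group) (use pair_finite_verts pair_finite_arcs arc_fst_in_verts in blast)+
  then show ?thesis
    by (simp add: deg_eq_card)
qed

text \<open>Take the start \<open>u\<close> of a longest path: a neighbour of \<open>u\<close> other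
  than the second vertex would either extend the path or close a cycle of length at least 3.\<close>

lemma (in pair_graph) ex_deg_le_1:
  assumes ne: "pverts G \<noteq> {}"
    and acyclic: "\<not> (\<exists>p. cycle p \<and> 3 \<le> length p)"
  shows "\<exists>v\<in>pverts G. deg G v \<le> 1"
proof (rule ccontr)
  assume "\<not> ?thesis"
  then have deg2: "2 \<le> deg G v" if "v \<in> pverts G" for v
    using that by force
  have other: "\<exists>w. (v, w) \<in> parcs G \<and> w \<noteq> x" if "v \<in> pverts G" for v x
  proof (rule ccontr)
    assume "\<not> ?thesis"
    then have "{e \<in> parcs G. fst e = v} \<subseteq> {(v, x)}" by auto
    then have "card {e \<in> parcs G. fst e = v} \<le> card {(v, x)}" by (intro card_mono) auto
    with deg2[OF that] show False by (simp add: deg_eq_card)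
  qed
  let ?L = "{length p |u p v. apath u p v}"
  from ne obtain z where "z \<in> pverts G" by auto
  then have "apath z [] z" by (simp add: apath_Nil_iff)
  then have Lne: "?L \<noteq> {}" by blast
  have "?L \<subseteq> {..<card (pverts G)}" using length_apath_less by auto
  then have Lfin: "finite ?L" by (rule finite_subset) simp
  from Max_in[OF Lfin Lne] obtain u p v where p: "apath u p v" "length p = Max ?L"
    by auto
  have maximal: "length q \<le> length p" if "apath a q b" for a q b
    unfolding p(2) using that by (intro Max_ge[OF Lfin]) blast
  have uG: "u \<in> pverts G" using p(1) by (auto simp: apath_def)
  \<comment> \<open>\<open>snd (hd p)\<close> is the second vertex of the path. For empty
    \<open>p\<close> it is an unspecified value, and then any neighbour of \<open>u\<close> extends
    the path.\<close>
  obtain w where w: "(u, w) \<in> parcs G" "w \<noteq> snd (hd p)"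
    using other[OF uG] by blast
  have wu: "(w, u) \<in> parcs G" using w(1) by (rule arcs_symmetric)
  have "w \<noteq> u" using no_loops'[OF w(1)] by simp
  have "w \<in> set (pawalk_verts u p)"
  proof (rule ccontr)
    assume "w \<notin> set (pawalk_verts u p)"
    then have "apath w ((w, u) # p) v" using wu p(1) by (simp add: apath_Cons_iff)
    from maximal[OF this] show False by simp
  qed
  moreover have "awalk u p v" using p(1) by (rule awalkI_apath)
  ultimately obtain q r where qr: "p = q @ r" "awalk u q w" "awalk w r v"
    using awalk_decomp by blast
  have dist: "distinct (pawalk_verts u q)"
    using p(1) unfolding qr(1) apath_append_iff by (simp add: apath_def)
  \<comment> \<open>A single arc \<open>q\<close> would be the first arc of \<open>p\<close>, whose
    head \<open>w\<close> was chosen to avoid. Hence closing \<open>q\<close> with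
    \<open>(w, u)\<close> gives length at least 3.\<close>
  have "2 \<le> length q"
  proof (cases q)
    case Nil
    with qr(2) \<open>w \<noteq> u\<close> show ?thesis by (simp add: awalk_Nil_iff)
  next
    case (Cons e q')
    with qr(1,2) w(2) show ?thesis by (cases q') (auto simp: awalk_simps)
  qed
  moreover have "awalk w ((w, u) # q) w" using qr(2) wu by (simp add: awalk_Cons_iff)
  then have "cycle ((w, u) # q)" using dist by (auto simp: cycle_def)
  ultimately show False using acyclic by force
qed

text \<open>Each edge counts as two arcs, so this says that a forest has fewer edges than vertices.
  Deleting a vertex of degree at most 1 keeps the graph acyclic and costs at most two arcs.\<close>

lemma card_parcs_forest_le:
  assumes "pair_graph G" "pverts G \<noteq> {}"
    and "\<not> (\<exists>p. pre_digraph.cycle (with_proj G) p \<and> 3 \<le> length p)"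
  shows "card (parcs G) + 2 \<le> 2 * card (pverts G)"
  using assms
proof (induction "card (pverts G)" arbitrary: G rule: less_induct)
  case less
  interpret pair_graph G by fact
  from ex_deg_le_1[OF less.prems(2,3)] obtain v
    where v: "v \<in> pverts G" "deg G v \<le> 1" by blast
  define H where
    "H = \<lparr>pverts = pverts G - {v}, parcs = {e \<in> parcs G. fst e \<noteq> v \<and> snd e \<noteq> v}\<rparr>"
  have cardH: "card (pverts G) = Suc (card (pverts H))"
    using card.remove[OF pair_finite_verts v(1)] by (simp add: H_def)
  \<comment> \<open>The induction hypothesis asks for a nonempty graph, so a single vertex is
    treated apart.\<close>
  show ?case
  proof (cases "pverts H = {}")
    case True
    then have "pverts G = {v}" using v(1) by (auto simp: H_def)
    then have "parcs G = {}" using no_loops' in_arcsD1 in_arcsD2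
      by (metis equals0I prod.exhaust singletonD)
    with \<open>pverts G = {v}\<close> show ?thesis by simp
  next
    case False
    have pgH: "pair_graph H"
    proof
      show "symmetric (with_proj H)"
        unfolding symmetric_def by (rule symI) (auto simp: H_def intro: arcs_symmetric)
    qed (auto simp: H_def pair_finite_verts pair_finite_arcs intro: arc_fst_in_verts
          arc_snd_in_verts dest: no_loops')
    interpret H: pair_graph H by fact
    have "subgraph (with_proj H) (with_proj G)"
      unfolding subgraph_def compatible_def
      using H.wf_digraph wf_digraph by (auto simp: H_def)
    then have "\<not> (\<exists>p. pre_digraph.cycle (with_proj H) p \<and> 3 \<le> length p)"
      using less.prems(3) subgraph_cycle by blast
    with less.hyps[of H] pgH False cardH
    have IH: "card (parcs H) + 2 \<le> 2 * card (pverts H)" by simp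
    let ?O = "{e \<in> parcs G. fst e = v}"
    \<comment> \<open>By symmetry the arcs entering \<open>v\<close> are the reversals of those
      leaving it.\<close>
    have "parcs G \<subseteq> parcs H \<union> (?O \<union> prod.swap ` ?O)"
    proof
      fix e assume e: "e \<in> parcs G"
      obtain a b where ab: "e = (a, b)" by (cases e)
      with e have "(b, a) \<in> parcs G" by (auto intro: arcs_symmetric)
      then have "b = v \<Longrightarrow> e \<in> prod.swap ` ?O" by (force simp: ab image_iff)
      then show "e \<in> parcs H \<union> (?O \<union> prod.swap ` ?O)" using e ab by (auto simp: H_def)
    qed
    moreover have fin: "finite ?O" "finite (parcs H)"
      using pair_finite_arcs H.pair_finite_arcs by auto
    ultimately have "card (parcs G) \<le> card (parcs H \<union> (?O \<union> prod.swap ` ?O))"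
      by (intro card_mono) auto
    also have "\<dots> \<le> card (parcs H) + (card ?O + card (prod.swap ` ?O))"
      by (meson card_Un_le add_left_mono order_trans)
    also have "\<dots> \<le> card (parcs H) + 2"
      using v(2) card_image_le[OF fin(1), of prod.swap] by (simp add: deg_eq_card)
    finally show ?thesis using IH cardH by simp
  qed
qed

text \<open>A path from \<open>v\<close> to a second vertex begins with an arc leaving
  \<open>v\<close>.\<close>

lemma deg_pos_if_connected:
  assumes "pair_graph G" "connected (with_proj G)" "2 \<le> card (pverts G)" "v \<in> pverts G"
  shows "1 \<le> deg G v"
proof -
  interpret pair_graph G by fact
  have "pverts G \<noteq> {v}" using assms(3) by auto
  then obtain u where u: "u \<in> pverts G" "u \<noteq> v" using assms(4) by auto
  have "strongly_connected (with_proj G)"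
    using symmetric_connected_imp_strongly_connected pair_sym_arcs assms(2) by blast
  then have "v \<rightarrow>\<^sup>*\<^bsub>with_proj G\<^esub> u" using u assms(4) by (simp add: strongly_connected_def)
  then obtain w where "(v, w) \<in> parcs G"
    using u(2) by (cases rule: converse_reachable_cases) auto
  then have "{e \<in> parcs G. fst e = v} \<noteq> {}" by auto
  then have "0 < card {e \<in> parcs G. fst e = v}"
    using pair_finite_arcs by (simp add: card_gt_0_iff)
  then show ?thesis by (simp add: deg_eq_card)
qed

section \<open>The lower bound\<close>

lemma card_le_sp:
  assumes "finite (pverts G)" "B \<subseteq> pverts G" "B \<noteq> {}" "spread G B \<le> k"
  shows "card B \<le> sp G k"
  unfolding sp_def
proof (rule Max_ge)
  have "{card B |B. B \<subseteq> pverts G \<and> B \<noteq> {} \<and> spread G B \<le> k} \<subseteq> card ` Pow (pverts G)"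
    by auto
  then show "finite {card B |B. B \<subseteq> pverts G \<and> B \<noteq> {} \<and> spread G B \<le> k}"
    by (rule finite_subset) (simp add: assms(1))
qed (use assms in blast)

lemma sp_le:
  assumes "finite (pverts G)" "pverts G \<noteq> {}"
    and "\<And>B. B \<subseteq> pverts G \<Longrightarrow> B \<noteq> {} \<Longrightarrow> spread G B \<le> k \<Longrightarrow> card B \<le> m"
  shows "sp G k \<le> m"
  unfolding sp_def
proof (subst Max_le_iff)
  have "{card B |B. B \<subseteq> pverts G \<and> B \<noteq> {} \<and> spread G B \<le> k} \<subseteq> card ` Pow (pverts G)"
    by auto
  then show "finite {card B |B. B \<subseteq> pverts G \<and> B \<noteq> {} \<and> spread G B \<le> k}"
    by (rule finite_subset) (simp add: assms(1))
  \<comment> \<open>Singletons have spread 0, so the maximum is over a nonempty set.\<close>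
  obtain v where "v \<in> pverts G" using assms(2) by auto
  then have "{v} \<subseteq> pverts G \<and> {v} \<noteq> {} \<and> spread G {v} \<le> k" by (simp add: spread_def)
  then show "{card B |B. B \<subseteq> pverts G \<and> B \<noteq> {} \<and> spread G B \<le> k} \<noteq> {}" by blast
qed (use assms(3) in blast)

lemma spread_le:
  assumes "finite B" "B \<noteq> {}" "\<And>v. v \<in> B \<Longrightarrow> l \<le> deg G v \<and> deg G v \<le> l + k"
  shows "spread G B \<le> k"
proof -
  have "Max (deg G ` B) \<le> l + k" "l \<le> Min (deg G ` B)"
    using assms by auto
  then show ?thesis by (simp add: spread_def)
qed

lemma deg_diff_le_spread:
  assumes "finite B" "u \<in> B" "v \<in> B"
  shows "deg G u - deg G v \<le> spread G B"
proof -
  have "deg G u \<le> Max (deg G ` B)" "Min (deg G ` B) \<le> deg G v"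
    using assms by auto
  then show ?thesis unfolding spread_def by linarith
qed

text \<open>The denominator \<open>k + 1\<close> is cleared so that the counting stays in the
  natural numbers.\<close>

lemma sp_tree_ge:
  assumes tree: "undirected_tree T" and n: "2 \<le> card (pverts T)"
  shows "card (pverts T) * k + 2 \<le> sp T k * (k + 1)"
proof -
  have pg: "pair_graph T" and conn: "connected (with_proj T)"
    and acyc: "\<not> (\<exists>p. pre_digraph.cycle (with_proj T) p \<and> 3 \<le> length p)"
    using tree by (auto simp: undirected_tree_def)
  interpret pair_graph T by fact
  let ?V = "pverts T"
  define B where "B = {v \<in> ?V. deg T v \<le> k + 1}"
  have ne: "?V \<noteq> {}" using n by auto
  have fin: "finite ?V" "finite B" using pair_finite_verts by (auto simp: B_def)
  have pos: "1 \<le> deg T v" if "v \<in> ?V" for v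
    using deg_pos_if_connected[OF pg conn n that] .
  have "(\<Sum>v\<in>?V. if v \<in> B then 1 else k + 2) \<le> (\<Sum>v\<in>?V. deg T v)"
    by (rule sum_mono) (use pos in \<open>auto simp: B_def\<close>)
  moreover have "(\<Sum>v\<in>?V. if v \<in> B then 1 else k + 2) = card B + card (?V - B) * (k + 2)"
  proof -
    have "?V \<inter> {v. v \<in> B} = B" "?V \<inter> - {v. v \<in> B} = ?V - B" by (auto simp: B_def)
    then show ?thesis using fin by (simp add: sum.If_cases)
  qed
  moreover have "(\<Sum>v\<in>?V. deg T v) + 2 \<le> 2 * card ?V"
    using card_parcs_forest_le[OF pg ne acyc] by (simp add: sum_deg)
  moreover have split: "card ?V = card B + card (?V - B)"
    using fin by (subst card_Un_disjoint[symmetric]) (auto simp: B_def intro: arg_cong[where f = card])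
  ultimately have le: "card ?V * k + 2 \<le> card B * (k + 1)"
    by (simp add: algebra_simps)
  \<comment> \<open>For empty \<open>B\<close> the right side would be 0, while the left side is at
    least 2.\<close>
  then have "B \<noteq> {}" by auto
  then have "spread T B \<le> k"
    using fin pos by (intro spread_le[where l = 1]) (auto simp: B_def)
  then have "card B \<le> sp T k"
    using fin \<open>B \<noteq> {}\<close> by (intro card_le_sp) (auto simp: B_def)
  then show ?thesis using le by (meson mult_le_mono1 order_trans)
qed

section \<open>Trees from parent functions\<close>

text \<open>A tree rooted at 0: the guards \<open>0 < u\<close> and \<open>0 < v\<close> ignore the
  value \<open>par 0\<close>, and the disjunction makes the arc set symmetric.\<close>

definition parent_graph :: "(nat \<Rightarrow> nat) \<Rightarrow> nat \<Rightarrow> nat pair_pre_digraph" where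
  "parent_graph par n = \<lparr>pverts = {..<n},
     parcs = {(u, v). u < n \<and> v < n \<and> (0 < u \<and> v = par u \<or> 0 < v \<and> u = par v)}\<rparr>"

text \<open>Iterating \<open>par\<close> descends to 0, which links every vertex to the root. Cycles
  are impossible because the only smaller neighbour of a vertex is its parent.\<close>

lemma undirected_tree_parent_graph:
  assumes par: "\<And>v. 0 < v \<Longrightarrow> v < n \<Longrightarrow> par v < v" and n: "0 < n"
  shows "undirected_tree (parent_graph par n)"
proof -
  let ?G = "parent_graph par n"
  have pg: "pair_graph ?G"
  proof
    show "symmetric (with_proj ?G)"
      unfolding symmetric_def by (rule symI) (auto simp: parent_graph_def)
    have "parcs ?G \<subseteq> {..<n} \<times> {..<n}" by (auto simp: parent_graph_def)
    then show "finite (parcs ?G)" by (rule finite_subset) simp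
  next
    fix e assume "e \<in> parcs ?G"
    then obtain a b where "e = (a, b)" "a < n" "b < n" "0 < a \<and> b = par a \<or> 0 < b \<and> a = par b"
      by (auto simp: parent_graph_def)
    then show "fst e \<noteq> snd e" using par[of a] par[of b] by auto
  qed (auto simp: parent_graph_def)
  interpret G: pair_graph ?G by fact
  have root: "v \<rightarrow>\<^sup>*\<^bsub>with_proj ?G\<^esub> 0" if "v < n" for v
    using that
  proof (induction v rule: less_induct)
    case (less v)
    show ?case
    proof (cases "v = 0")
      case True
      then show ?thesis using n G.reachable_refl[of 0] by (simp add: parent_graph_def)
    next
      case False
      then have "par v < v" using par less.prems by simp
      then have "(v, par v) \<in> parcs ?G" using False less.prems by (simp add: parent_graph_def)
      then show ?thesis
        using less.IH[OF \<open>par v < v\<close>] \<open>par v < v\<close> less.prems G.adj_reachable_trans by simp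
    qed
  qed
  have "connected (with_proj ?G)"
  proof (rule G.connectedI)
    show "pverts ?G \<noteq> {}" using n by (auto simp: parent_graph_def)
  next
    fix u v assume "u \<in> pverts ?G" "v \<in> pverts ?G"
    then have "u \<rightarrow>\<^sup>*\<^bsub>with_proj ?G\<^esub> 0" "0 \<rightarrow>\<^sup>*\<^bsub>with_proj ?G\<^esub> v"
      using root G.symmetric_reachable' by (simp_all add: parent_graph_def)
    then have "u \<rightarrow>\<^sup>*\<^bsub>with_proj ?G\<^esub> v" by (rule G.reachable_trans)
    then show "u \<rightarrow>\<^sup>*\<^bsub>with_proj (mk_symmetric (with_proj ?G))\<^esub> v"
      by (rule G.reachable_mk_symmetricI)
  qed
  moreover have "\<not> (\<exists>p. pre_digraph.cycle (with_proj ?G) p \<and> 3 \<le> length p)"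
  proof clarify
    fix p assume "G.cycle p" and len: "3 \<le> length p"
    then obtain u where u: "G.awalk u p u" "distinct (tl (pawalk_verts u p))" "p \<noteq> []"
      by (auto simp: G.cycle_def)
    have "pcas u p u" using u(1) by auto
    \<comment> \<open>Without its first entry the vertex list is the list of arc heads; their
      distinctness survives rotation.\<close>
    then have dist: "distinct (map snd p)"
      using u(2,3) by (simp add: G.awalk_verts_conv')
    \<comment> \<open>Both neighbours on the cycle of its largest vertex are the parent of that vertex.\<close>
    define M where "M = Max (set (pawalk_verts u p))"
    have "M \<in> set (pawalk_verts u p)" unfolding M_def by (rule Max_in) auto
    with u(1) obtain q r where qr: "p = q @ r" "G.awalk M (r @ q) M"
      "set (pawalk_verts M (r @ q)) = set (pawalk_verts u p)"
      by (rule G.rotate_awalkE)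
    define c where "c = r @ q"
    have c: "G.awalk M c M" "distinct (map snd c)" "3 \<le> length c"
      using qr dist len by (auto simp: c_def)
    have le: "x \<le> M" if "x \<in> set (pawalk_verts M c)" for x
      using that qr(3) Max_ge[of "set (pawalk_verts u p)" x] by (simp add: c_def flip: M_def)
    obtain e c' f where ef: "c = e # c' @ [f]" "c' \<noteq> []"
    proof -
      obtain e c1 where "c = e # c1" "2 \<le> length c1"
        using c(3) by (cases c) auto
      then show ?thesis
        using that[of e "butlast c1" "last c1"] by (cases c1 rule: rev_cases) (auto simp: Suc_le_length_iff)
    qed
    have arcs: "e \<in> parcs ?G" "f \<in> parcs ?G" "fst e = M" "snd f = M"
      and adj: "fst f = snd (last c')"
      using c(1) ef by (auto simp: G.awalk_simps G.awalk_verts_conv)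
    have "snd e \<le> M" "fst f \<le> M"
      using c(1) ef G.awalk_verts_arc1[of f c M] G.awalk_verts_arc2[of M c M e] le by auto
    \<comment> \<open>Otherwise \<open>snd e\<close> would be a child of \<open>M\<close> and hence
      larger than \<open>M\<close>.\<close>
    have "snd e = par M"
      using arcs(1,3) \<open>snd e \<le> M\<close> par[of "snd e"] by (auto simp: parent_graph_def)
    moreover have "fst f = par M"
      using arcs(2,4) \<open>fst f \<le> M\<close> par[of "fst f"] by (auto simp: parent_graph_def)
    \<comment> \<open>The tail of \<open>f\<close> is the head of the last arc of \<open>c'\<close>,
      so \<open>par M\<close> occurs twice among the distinct arc heads. Length at least 3 is what
      makes \<open>c'\<close> nonempty.\<close>
    ultimately have "snd e \<in> snd ` set c'" using adj ef(2) by (metis image_eqI last_in_set)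
    then show False using c(2) ef by auto
  qed
  ultimately show ?thesis using pg by (simp add: undirected_tree_def)
qed

text \<open>The neighbours of \<open>u\<close> are its children and, unless \<open>u\<close> is the
  root, its parent; the two kinds are disjoint because \<open>par\<close> decreases.\<close>

lemma deg_parent_graph:
  assumes par: "\<And>v. 0 < v \<Longrightarrow> v < n \<Longrightarrow> par v < v" and u: "u < n"
  shows "deg (parent_graph par n) u
    = card {v. 0 < v \<and> v < n \<and> par v = u} + (if u = 0 then 0 else 1)"
proof -
  let ?C = "{v. 0 < v \<and> v < n \<and> par v = u}"
  let ?P = "if u = 0 then {} else {par u}"
  have "{e \<in> parcs (parent_graph par n). fst e = u} = Pair u ` (?C \<union> ?P)"
    using u par[of u] by (auto simp: parent_graph_def)
  then have "deg (parent_graph par n) u = card (?C \<union> ?P)"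
    by (simp add: deg_eq_card card_image inj_on_def)
  also have "\<dots> = card ?C + card ?P"
    using u par[of u] par[of "par u"] by (intro card_Un_disjoint) fastforce+
  finally show ?thesis by simp
qed

section \<open>Sharpness\<close>

text \<open>For \<open>0 < m\<close> the numbering is breadth first: 0 has the children
  \<open>1\<close> to \<open>k + 2\<close>, and each later inner vertex the next
  \<open>k + 1\<close> numbers. Truncated subtraction gives 1 the parent 0, an extra child that
  makes up for the root's missing parent.\<close>

definition extremal_tree :: "nat \<Rightarrow> nat \<Rightarrow> nat pair_pre_digraph" where
  "extremal_tree k m = parent_graph (\<lambda>v. (v - 2) div (k + 1)) (m * (k + 1) + 2)"

lemma extremal_parent_less: "0 < v \<Longrightarrow> (v - 2) div (k + 1) < (v :: nat)"
  by (meson diff_less div_le_dividend le_less_trans zero_less_numeral)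

lemma undirected_tree_extremal_tree: "undirected_tree (extremal_tree k m)"
  unfolding extremal_tree_def
  using extremal_parent_less by (intro undirected_tree_parent_graph) auto

lemma pverts_extremal_tree: "pverts (extremal_tree k m) = {..<m * (k + 1) + 2}"
  by (simp add: extremal_tree_def parent_graph_def)

lemma deg_extremal_tree:
  assumes m: "0 < m" and u: "u < m * (k + 1) + 2"
  shows "deg (extremal_tree k m) u = (if u < m then k + 2 else 1)"
proof -
  let ?n = "m * (k + 1) + 2"
  let ?C = "{v. 0 < v \<and> v < ?n \<and> (v - 2) div (k + 1) = u}"
  have iff: "(v - 2) div (k + 1) = u \<longleftrightarrow> u * (k + 1) \<le> v - 2 \<and> v - 2 < (u + 1) * (k + 1)" for v
  proof -
    have "x = u \<longleftrightarrow> u \<le> x \<and> x < u + 1" for x by auto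
    then show ?thesis by (simp only: less_eq_div_iff_mult_less_eq div_less_iff_less_mult)
  qed
  have deg: "deg (extremal_tree k m) u = card ?C + (if u = 0 then 0 else 1)"
    unfolding extremal_tree_def by (rule deg_parent_graph) (rule extremal_parent_less, assumption, rule u)
  show ?thesis
  proof (cases "u < m")
    case True
    then have "(u + 1) * (k + 1) \<le> m * (k + 1)" by (intro mult_le_mono1) simp
    show ?thesis
    proof (cases "u = 0")
      case True
      have "?C = {1..k + 2}"
        unfolding iff using \<open>(u + 1) * (k + 1) \<le> m * (k + 1)\<close> True by auto
      then show ?thesis using deg True m by simp
    next
      case False
      \<comment> \<open>The lower bound on \<open>v - 2\<close> is positive, so no truncation occurs
        and the children form a block of \<open>k + 1\<close> numbers.\<close>
      then have "k + 1 \<le> u * (k + 1)" by (cases u) auto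
      then have "?C = {u * (k + 1) + 2..<(u + 1) * (k + 1) + 2}"
        unfolding iff using \<open>(u + 1) * (k + 1) \<le> m * (k + 1)\<close> by auto
      then show ?thesis using deg False \<open>u < m\<close> by simp
    qed
  next
    case False
    then have "m * (k + 1) \<le> u * (k + 1)" "0 < u"
      using m by (auto intro!: mult_le_mono1 simp del: mult_Suc_right add_Suc_right)
    \<comment> \<open>This excludes \<open>v = 1\<close>, for which \<open>v - 2\<close> is
      truncated to 0.\<close>
    moreover have "0 < m * (k + 1)" using m by simp
    ultimately have "?C = {}" unfolding iff by auto
    then show ?thesis using deg False \<open>0 < u\<close> by simp
  qed
qed

text \<open>The degrees 1 and \<open>k + 2\<close> differ by more than \<open>k\<close>, so an
  admissible set has only leaves or only inner vertices. The \<open>m * k + 2\<close> leaves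
  outnumber the \<open>m\<close> inner vertices since \<open>1 \<le> k\<close>.\<close>

lemma sp_extremal_tree:
  assumes "1 \<le> k" "0 < m"
  shows "sp (extremal_tree k m) k = m * k + 2"
proof (rule antisym)
  let ?T = "extremal_tree k m" and ?n = "m * (k + 1) + 2"
  have fin: "finite (pverts ?T)" and ne: "pverts ?T \<noteq> {}" by (auto simp: pverts_extremal_tree)
  show "sp ?T k \<le> m * k + 2"
  proof (rule sp_le[OF fin ne])
    fix B assume B: "B \<subseteq> pverts ?T" "B \<noteq> {}" "spread ?T B \<le> k"
    have finB: "finite B" using B(1) fin by (rule finite_subset)
    show "card B \<le> m * k + 2"
    proof (cases "B \<subseteq> {..<m}")
      case True
      then have "card B \<le> m" using card_mono[of "{..<m}" B] by simp
      also have "m \<le> m * k" using assms by simp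
      finally show ?thesis by simp
    next
      case False
      then obtain v where v: "v \<in> B" "m \<le> v" by (meson lessThan_iff not_less subsetI)
      have "B \<subseteq> {m..<?n}"
      proof
        fix u assume u: "u \<in> B"
        have "deg ?T u - deg ?T v \<le> k"
          using deg_diff_le_spread[OF finB u v(1)] B(3) by (rule order_trans)
        moreover have "u < ?n" "v < ?n" using u v(1) B(1) by (auto simp: pverts_extremal_tree)
        ultimately show "u \<in> {m..<?n}"
          using v(2) deg_extremal_tree[OF assms(2)] by (cases "u < m") auto
      qed
      then have "card B \<le> card {m..<?n}" by (intro card_mono) auto
      then show ?thesis by simp
    qed
  qed
  have "spread ?T {m..<?n} \<le> k"
    using deg_extremal_tree[OF assms(2)] by (intro spread_le[where l = 1]) auto
  then have "card {m..<?n} \<le> sp ?T k"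
    by (intro card_le_sp[OF fin]) (auto simp: pverts_extremal_tree)
  then show "m * k + 2 \<le> sp ?T k" by simp
qed

theorem theorem3p1:
  fixes k :: nat
  assumes "k \<ge> 1"
  shows "(\<forall>T :: 'a pair_pre_digraph. \<forall>n :: nat.
            undirected_tree T \<and> card (pverts T) = n \<and> n \<ge> k + 2 \<longrightarrow>
            real (sp T k) \<ge> (real n * real k + 2) / (real k + 1)) \<and>
         infinite {n :: nat. n \<ge> k + 2 \<and>
            (\<exists>T :: nat pair_pre_digraph. undirected_tree T \<and> card (pverts T) = n \<and>
               real (sp T k) = (real n * real k + 2) / (real k + 1))}"
proof (intro conjI allI impI)
  fix T :: "'a pair_pre_digraph" and n :: nat
  assume "undirected_tree T \<and> card (pverts T) = n \<and> n \<ge> k + 2"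
  then have "n * k + 2 \<le> sp T k * (k + 1)" using sp_tree_ge[of T k] by auto
  then have "real (n * k + 2) \<le> real (sp T k * (k + 1))" by (simp only: of_nat_le_iff)
  then show "real (sp T k) \<ge> (real n * real k + 2) / (real k + 1)"
    by (simp add: divide_le_eq algebra_simps)
next
  let ?S = "{n :: nat. n \<ge> k + 2 \<and>
            (\<exists>T :: nat pair_pre_digraph. undirected_tree T \<and> card (pverts T) = n \<and>
               real (sp T k) = (real n * real k + 2) / (real k + 1))}"
  \<comment> \<open>\<open>Suc m\<close> guarantees an inner vertex and makes the order at least
    \<open>k + 3\<close>.\<close>
  have "Suc m * (k + 1) + 2 \<in> ?S" for m
  proof (intro CollectI conjI exI[of _ "extremal_tree k (Suc m)"])
    show "real (sp (extremal_tree k (Suc m)) k)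
      = (real (Suc m * (k + 1) + 2) * real k + 2) / (real k + 1)"
      using assms by (simp add: sp_extremal_tree field_simps)
  qed (simp_all add: undirected_tree_extremal_tree pverts_extremal_tree)
  then have "range (\<lambda>m. Suc m * (k + 1) + 2) \<subseteq> ?S" by blast
  moreover have "infinite (range (\<lambda>m. Suc m * (k + 1) + 2))"
    by (intro range_inj_infinite injI)
      (metis Suc_inject add_right_cancel mult_right_cancel zero_neq_one add_is_0)
  ultimately show "infinite ?S" by (rule infinite_super)
qed

end
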